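(* For every $\gamma\in[0,1]$ and every instance of MP-KHD, $\mathbb{E}[\text{profit of }\mathsf{SAMP}(\gamma)]\ge\gamma(1-\gamma)\cdot\mathrm{OPT\text{-}OFF}$; i.e., $\mathsf{SAMP}(\gamma)$ achieves competitive ratio $\gamma(1-\gamma)$.
   Context: An instance of MP-KHD consists of: a bipartite graph $G=(I,J,E)$ with finite sets $I$ (offline agent types) and $J$ (online agent types); a finite set of prices $\{a_1,\dots,a_K\}$; a capacity $b_i\in\mathbb{Z}_{>0}$ for each $i\in I$; a horizon $T\in\mathbb{Z}_{>0}$; for each $t\in[T]$ a probability distribution $(q_{j,t})_{j\in J}$ on $J$; the assignment set $\mathcal{F}=\{(i,j,k):(i,j)\in E,k\in[K]\}$; for each $f\in\mathcal{F}$, $t\in[T]$, an acceptance probability $p_{f,t}\in(0,1]$ and profit $w_{f,t}\ge0$. $\mathcal{F}_j$ ($\mathcal{F}_i$) is the set of assignments with second (first) coordinate $j$ ($i$). The instance is known in advance. In each round $t$, an online agent type $\hat j_t$ arrives, independently across rounds, with $\Pr[\hat j_t=j]=q_{j,t}$; the policy irrevocably rejects it or selects one $f=(i,\hat j_t,k)\in\mathcal{F}_{\hat j_t}$ with $i$ having remaining capacity; the agent independently accepts with probability $p_{f,t}$ (then $i$'s capacity drops by one and profit $w_{f,t}$ is earned), else nothing happens. $\mathrm{OPT\text{-}OFF}$ is the maximum expected total profit of a clairvoyant policy that observes the whole arrival sequence before deciding. Policy $\mathsf{SAMP}(\gamma)$, $\gamma\in[0,1]$: replace each offline type $i$ by $b_i$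 copies of capacity 1 (inheriting $i$'s edges, probabilities and profits), and work with this unit-capacity instance. Solve the LP $\max\sum_{t,f}x_{f,t}p_{f,t}w_{f,t}$ s.t. $\sum_{f\in\mathcal{F}_j}x_{f,t}\le q_{j,t}$ for all $j,t$; $\sum_t\sum_{f\in\mathcal{F}_i}x_{f,t}p_{f,t}\le1$ for all $i$; $x\ge0$; let $x$ be an optimal solution. In round $t$, when $j$ arrives, sample at most one assignment, choosing each $f\in\mathcal{F}_j$ with probability $\gamma x_{f,t}/q_{j,t}$; if some $f=(i,j,k)$ is sampled and $i$ still has its unit of capacity, select $f$; otherwise reject. *)

theory Defs
  imports "HOL-Probability.Probability"
begin

text \<open>
  An assignment \<open>(i, j, k)\<close> offers the \<open>k\<close>-th price, \<open>k \<in> {1..K}\<close>, to the pair \<open>(i, j)\<close>.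
  Rounds are numbered \<open>1, \<dots>, T\<close>.  Functions indexed by agents, assignments or rounds are total;
  only their values on the index sets of the instance are constrained or used.
\<close>

type_synonym ('i, 'j) assignment = "'i \<times> 'j \<times> nat"

record ('i, 'j) mp_khd =
  offline :: "'i set"
  online :: "'j set"
  edges :: "('i \<times> 'j) set"
  num_prices :: nat
  price :: "nat \<Rightarrow> real"
  capacity :: "'i \<Rightarrow> nat"
  horizon :: nat
  arrival :: "nat \<Rightarrow> 'j pmf"
  accept_prob :: "('i, 'j) assignment \<Rightarrow> nat \<Rightarrow> real"
  profit :: "('i, 'j) assignment \<Rightarrow> nat \<Rightarrow> real"

definition rounds :: "('i, 'j) mp_khd \<Rightarrow> nat set" where
  "rounds M = {1..horizon M}"

definition assignments :: "('i, 'j) mp_khd \<Rightarrow> ('i, 'j) assignment set" where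
  "assignments M = {(i, j, k). (i, j) \<in> edges M \<and> k \<in> {1..num_prices M}}"

definition assignments_offline :: "('i, 'j) mp_khd \<Rightarrow> 'i \<Rightarrow> ('i, 'j) assignment set" where
  "assignments_offline M i = {f \<in> assignments M. fst f = i}"

definition assignments_online :: "('i, 'j) mp_khd \<Rightarrow> 'j \<Rightarrow> ('i, 'j) assignment set" where
  "assignments_online M j = {f \<in> assignments M. fst (snd f) = j}"

definition valid_mp_khd :: "('i, 'j) mp_khd \<Rightarrow> bool" where
  "valid_mp_khd M \<longleftrightarrow>
     finite (offline M) \<and> finite (online M) \<and> edges M \<subseteq> offline M \<times> online M \<and>
     (\<forall>i\<in>offline M. capacity M i > 0) \<and> horizon M > 0 \<and>
     (\<forall>t\<in>rounds M. set_pmf (arrival M t) \<subseteq> online M) \<and>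
     (\<forall>f\<in>assignments M. \<forall>t\<in>rounds M. 0 < accept_prob M f t \<and> accept_prob M f t \<le> 1) \<and>
     (\<forall>f\<in>assignments M. \<forall>t\<in>rounds M. profit M f t \<ge> 0)"

text \<open>
  The entry of a history for one round is \<open>None\<close> if the arriving agent was rejected, and
  \<open>Some (f, a)\<close> if \<open>f\<close> was selected, where \<open>a\<close> tells whether the agent accepted.  A history
  \<open>h\<close> is what precedes round \<open>Suc (length h)\<close>.
\<close>

type_synonym ('i, 'j) history = "(('i, 'j) assignment \<times> bool) option list"

text \<open>
  A policy sees the arrival sequence \<open>js\<close> and the history, and may randomize.  Acceptance
  outcomes are revealed to it only through the history, so also a policy that uses all of \<open>js\<close>
  (a clairvoyant one) does not know the outcomes of future offers.
\<close>

type_synonym ('i, 'j) policy = "(nat \<Rightarrow> 'j) \<Rightarrow> ('i, 'j) history \<Rightarrow> ('i, 'j) assignment option pmf"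

definition used :: "('i, 'j) history \<Rightarrow> 'i \<Rightarrow> nat" where
  "used h i = length (filter (\<lambda>e. \<exists>f. e = Some (f, True) \<and> fst f = i) h)"

definition available :: "('i, 'j) mp_khd \<Rightarrow> ('i, 'j) history \<Rightarrow> 'i \<Rightarrow> bool" where
  "available M h i \<longleftrightarrow> used h i < capacity M i"

definition clairvoyant_policy :: "('i, 'j) mp_khd \<Rightarrow> ('i, 'j) policy \<Rightarrow> bool" where
  "clairvoyant_policy M \<pi> \<longleftrightarrow>
     (\<forall>js h. length h < horizon M \<longrightarrow>
        set_pmf (\<pi> js h) \<subseteq>
          insert None (Some ` {f \<in> assignments_online M (js (Suc (length h))). available M h (fst f)}))"

definition online_policy ::
  "(('i, 'j) history \<Rightarrow> 'j \<Rightarrow> ('i, 'j) assignment option pmf) \<Rightarrow> ('i, 'j) policy" where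
  "online_policy \<sigma> = (\<lambda>js h. \<sigma> h (js (Suc (length h))))"

definition arrivals :: "('i, 'j) mp_khd \<Rightarrow> (nat \<Rightarrow> 'j) pmf" where
  "arrivals M = Pi_pmf (rounds M) undefined (arrival M)"

fun offer ::
  "('i, 'j) mp_khd \<Rightarrow> nat \<Rightarrow> ('i, 'j) assignment option \<Rightarrow> (('i, 'j) assignment \<times> bool) option pmf" where
  "offer M t None = return_pmf None"
| "offer M t (Some f) = map_pmf (\<lambda>a. Some (f, a)) (bernoulli_pmf (accept_prob M f t))"

primrec run :: "('i, 'j) mp_khd \<Rightarrow> ('i, 'j) policy \<Rightarrow> (nat \<Rightarrow> 'j) \<Rightarrow> nat \<Rightarrow> ('i, 'j) history pmf" where
  "run M \<pi> js 0 = return_pmf []"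
| "run M \<pi> js (Suc n) =
     bind_pmf (run M \<pi> js n) (\<lambda>h.
     bind_pmf (\<pi> js h) (\<lambda>c.
     map_pmf (\<lambda>e. h @ [e]) (offer M (Suc n) c)))"

definition total_profit :: "('i, 'j) mp_khd \<Rightarrow> ('i, 'j) history \<Rightarrow> real" where
  "total_profit M h =
     (\<Sum>n<length h. case h ! n of Some (f, True) \<Rightarrow> profit M f (Suc n) | _ \<Rightarrow> 0)"

definition expected_profit :: "('i, 'j) mp_khd \<Rightarrow> ('i, 'j) policy \<Rightarrow> real" where
  "expected_profit M \<pi> =
     measure_pmf.expectation (bind_pmf (arrivals M) (\<lambda>js. run M \<pi> js (horizon M))) (total_profit M)"

text \<open>
  For a valid instance the set of expected profits of clairvoyant policies is nonempty (reject everyone) and bounded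
  (by \<open>T\<close> times the largest profit), so the supremum is a genuine one.
\<close>

definition opt_off :: "('i, 'j) mp_khd \<Rightarrow> real" where
  "opt_off M = (SUP \<pi>\<in>{\<pi>. clairvoyant_policy M \<pi>}. expected_profit M \<pi>)"

definition unit_copies :: "('i, 'j) mp_khd \<Rightarrow> ('i \<times> nat, 'j) mp_khd" where
  "unit_copies M =
     \<lparr>offline = (SIGMA i:offline M. {1..capacity M i}),
      online = online M,
      edges = {((i, c), j). (i, j) \<in> edges M \<and> c \<in> {1..capacity M i}},
      num_prices = num_prices M,
      price = price M,
      capacity = (\<lambda>_. 1),
      horizon = horizon M,
      arrival = arrival M,
      accept_prob = (\<lambda>((i, c), j, k). accept_prob M (i, j, k)),
      profit = (\<lambda>((i, c), j, k). profit M (i, j, k))\<rparr>"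

text \<open>Meant for unit-capacity instances, hence the bound \<open>1\<close> for each offline agent.\<close>

definition lp_feasible :: "('i, 'j) mp_khd \<Rightarrow> (('i, 'j) assignment \<Rightarrow> nat \<Rightarrow> real) \<Rightarrow> bool" where
  "lp_feasible M x \<longleftrightarrow>
     (\<forall>j\<in>online M. \<forall>t\<in>rounds M. (\<Sum>f\<in>assignments_online M j. x f t) \<le> pmf (arrival M t) j) \<and>
     (\<forall>i\<in>offline M. (\<Sum>t\<in>rounds M. \<Sum>f\<in>assignments_offline M i. x f t * accept_prob M f t) \<le> 1) \<and>
     (\<forall>f\<in>assignments M. \<forall>t\<in>rounds M. x f t \<ge> 0)"

definition lp_value :: "('i, 'j) mp_khd \<Rightarrow> (('i, 'j) assignment \<Rightarrow> nat \<Rightarrow> real) \<Rightarrow> real" where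
  "lp_value M x =
     (\<Sum>t\<in>rounds M. \<Sum>f\<in>assignments M. x f t * accept_prob M f t * profit M f t)"

definition lp_optimal :: "('i, 'j) mp_khd \<Rightarrow> (('i, 'j) assignment \<Rightarrow> nat \<Rightarrow> real) \<Rightarrow> bool" where
  "lp_optimal M x \<longleftrightarrow> lp_feasible M x \<and> (\<forall>y. lp_feasible M y \<longrightarrow> lp_value M y \<le> lp_value M x)"

text \<open>
  The sampling distribution in round \<open>t\<close> for an agent of type \<open>j\<close>.  For feasible \<open>x\<close> and
  \<open>0 \<le> \<gamma> \<le> 1\<close> the argument of \<^const>\<open>embed_pmf\<close> is a probability mass function; see
  \<open>pmf_sample\<close> below.  If \<open>j\<close> has arrival probability \<open>0\<close>, division by zero makes it
  \<open>return_pmf None\<close>, which is irrelevant because such a \<open>j\<close> almost surely does not arrive.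
\<close>

definition sample_weight ::
  "('i, 'j) mp_khd \<Rightarrow> real \<Rightarrow> (('i, 'j) assignment \<Rightarrow> nat \<Rightarrow> real) \<Rightarrow> nat \<Rightarrow> 'j \<Rightarrow>
   ('i, 'j) assignment option \<Rightarrow> real" where
  "sample_weight M \<gamma> x t j c =
     (case c of
        Some f \<Rightarrow> if f \<in> assignments_online M j then \<gamma> * x f t / pmf (arrival M t) j else 0
      | None \<Rightarrow> 1 - (\<Sum>f\<in>assignments_online M j. \<gamma> * x f t / pmf (arrival M t) j))"

definition sample ::
  "('i, 'j) mp_khd \<Rightarrow> real \<Rightarrow> (('i, 'j) assignment \<Rightarrow> nat \<Rightarrow> real) \<Rightarrow> nat \<Rightarrow> 'j \<Rightarrow>
   ('i, 'j) assignment option pmf" where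
  "sample M \<gamma> x t j = embed_pmf (sample_weight M \<gamma> x t j)"

definition samp ::
  "('i, 'j) mp_khd \<Rightarrow> real \<Rightarrow> (('i, 'j) assignment \<Rightarrow> nat \<Rightarrow> real) \<Rightarrow> ('i, 'j) policy" where
  "samp M \<gamma> x = online_policy (\<lambda>h j.
     map_pmf
       (\<lambda>c. case c of
              Some f \<Rightarrow> if available M h (fst f) then Some f else None
            | None \<Rightarrow> None)
       (sample M \<gamma> x (Suc (length h)) j))"

lemma finite_assignments:
  assumes "valid_mp_khd M"
  shows "finite (assignments M)"
proof -
  have "finite (edges M)"
    using assms unfolding valid_mp_khd_def by (meson finite_SigmaI finite_subset)
  moreover have "assignments M \<subseteq> (\<lambda>((i, j), k). (i, j, k)) ` (edges M \<times> {1..num_prices M})"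
    by (force simp: assignments_def)
  ultimately show ?thesis
    by (meson finite_SigmaI finite_atLeastAtMost finite_imageI finite_subset)
qed

lemma valid_unit_copies:
  assumes "valid_mp_khd M"
  shows "valid_mp_khd (unit_copies M)"
  using assms unfolding valid_mp_khd_def unit_copies_def rounds_def assignments_def
  by (auto intro!: finite_SigmaI)

lemma pmf_sample:
  assumes M: "valid_mp_khd M" and x: "lp_feasible M x" and \<gamma>: "0 \<le> \<gamma>" "\<gamma> \<le> 1"
    and j: "j \<in> online M" and t: "t \<in> rounds M"
  shows "pmf (sample M \<gamma> x t j) c = sample_weight M \<gamma> x t j c"
proof -
  let ?A = "assignments_online M j" and ?q = "pmf (arrival M t) j"
  let ?w = "sample_weight M \<gamma> x t j"
  have fin: "finite ?A"
    using finite_assignments[OF M] by (simp add: assignments_online_def)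
  have x0: "x f t \<ge> 0" if "f \<in> ?A" for f
    using x t that by (auto simp: lp_feasible_def assignments_online_def)
  have "(\<Sum>f\<in>?A. \<gamma> * x f t / ?q) = \<gamma> * ((\<Sum>f\<in>?A. x f t) / ?q)"
    by (simp add: sum_distrib_left sum_divide_distrib)
  also have "\<dots> \<le> 1 * 1"
  proof (rule mult_mono)
    have "(\<Sum>f\<in>?A. x f t) \<le> ?q"
      using x j t by (auto simp: lp_feasible_def)
    then show "(\<Sum>f\<in>?A. x f t) / ?q \<le> 1"
      by (cases "?q = 0") (auto simp: divide_le_eq pmf_pos)
    show "0 \<le> (\<Sum>f\<in>?A. x f t) / ?q"
      by (intro divide_nonneg_nonneg sum_nonneg x0) auto
  qed (use \<gamma> in auto)
  finally have le1: "(\<Sum>f\<in>?A. \<gamma> * x f t / ?q) \<le> 1" by simp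
  have nonneg: "?w c \<ge> 0" for c
    using le1 x0 \<gamma> by (auto simp: sample_weight_def split: option.splits)
  have "(\<integral>\<^sup>+ c. ennreal (?w c) \<partial>count_space UNIV) = (\<Sum>c\<in>insert None (Some ` ?A). ennreal (?w c))"
    using fin by (intro nn_integral_count_space'[symmetric, THEN sym])
      (auto simp: sample_weight_def split: option.splits)
  also have "\<dots> = ennreal (\<Sum>c\<in>insert None (Some ` ?A). ?w c)"
    by (rule sum_ennreal) (use nonneg in auto)
  also have "(\<Sum>c\<in>insert None (Some ` ?A). ?w c) = 1"
    using fin by (simp add: sum.reindex sample_weight_def)
  finally show ?thesis
    unfolding sample_def using nonneg by (intro pmf_embed_pmf) auto
qed

end

theory Submission
  imports Defs
begin

text \<open>
  The selection probabilities of a clairvoyant policy, divided evenly among the copies of each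
  offline agent, are feasible for the LP: an assignment can only be selected when its online agent
  arrives, and the expected number of accepted offers of an agent is at most its capacity.  Hence
  the LP value bounds the clairvoyant optimum.  The sampling policy selects \<open>f\<close> in round \<open>t\<close> with
  probability \<open>\<gamma> x\<^sub>f\<^sub>t\<close> times the probability that its offline agent is still free; the agent
  is used up by then with probability at most \<open>\<gamma>\<close>, by Markov's inequality and its LP constraint.
\<close>

section \<open>Expectations under finitely supported distributions\<close>

lemma expectation_bind_pmf_finite:
  fixes h :: "'b \<Rightarrow> real"
  assumes "finite (set_pmf p)" and "\<And>x. x \<in> set_pmf p \<Longrightarrow> finite (set_pmf (f x))"
  shows "measure_pmf.expectation (bind_pmf p f) h =
    measure_pmf.expectation p (\<lambda>x. measure_pmf.expectation (f x) h)"
proof -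
  have "measure_pmf.expectation (bind_pmf p f) h =
      (\<Sum>a\<in>set_pmf p. pmf p a *\<^sub>R measure_pmf.expectation (f a) h)"
    by (rule pmf_expectation_bind) (use assms in auto)
  also have "\<dots> = measure_pmf.expectation p (\<lambda>x. measure_pmf.expectation (f x) h)"
    by (rule integral_measure_pmf[symmetric]) (use assms in auto)
  finally show ?thesis .
qed

lemma expectation_mono_finite:
  fixes f g :: "'a \<Rightarrow> real"
  assumes "finite (set_pmf p)" and "\<And>x. x \<in> set_pmf p \<Longrightarrow> f x \<le> g x"
  shows "measure_pmf.expectation p f \<le> measure_pmf.expectation p g"
  by (rule integral_mono_AE)
    (use assms in \<open>auto intro: integrable_measure_pmf_finite simp: AE_measure_pmf_iff\<close>)

lemma expectation_cong_pmf:
  fixes f g :: "'a \<Rightarrow> real"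
  assumes "\<And>x. x \<in> set_pmf p \<Longrightarrow> f x = g x"
  shows "measure_pmf.expectation p f = measure_pmf.expectation p g"
  by (rule integral_cong_AE) (use assms in \<open>auto simp: AE_measure_pmf_iff\<close>)

text \<open>Independence in product form: the hypothesis on \<open>F\<close> says that it ignores
  coordinate \<open>t\<close>. Later \<open>F\<close> is the probability that an agent is still
  free, and \<open>G\<close> concerns the type arriving in round \<open>t\<close>.\<close>

lemma expectation_Pi_pmf_component_mult:
  fixes F :: "('a \<Rightarrow> 'b) \<Rightarrow> real" and G :: "'b \<Rightarrow> real"
  assumes "finite A" and "t \<in> A" and fin: "\<And>a. a \<in> A \<Longrightarrow> finite (set_pmf (p a))"
    and F: "\<And>js a. F (js(t := a)) = F js"
  shows "measure_pmf.expectation (Pi_pmf A d p) (\<lambda>js. F js * G (js t)) =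
    measure_pmf.expectation (Pi_pmf A d p) F * measure_pmf.expectation (p t) G"
proof -
  define B where "B = A - {t}"
  have A: "A = insert t B" "t \<notin> B" "finite B"
    using assms by (auto simp: B_def)
  have "finite (set_pmf (Pi_pmf B d p))"
    using A fin by (auto simp: set_Pi_pmf)
  \<comment> \<open>A general \<open>H\<close> is needed because the identity is used twice: with
    \<open>G\<close>, and with the constant 1, which identifies the mean of \<open>F\<close> over
    the coordinates in \<open>B\<close> with its mean over those in \<open>A\<close>.\<close>
  have *: "measure_pmf.expectation (Pi_pmf A d p) (\<lambda>js. F js * H (js t)) =
      measure_pmf.expectation (Pi_pmf B d p) F * measure_pmf.expectation (p t) H" for H :: "'b \<Rightarrow> real"
  proof -
    \<comment> \<open>Draw the other coordinates first and coordinate \<open>t\<close> last, so that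
      \<open>F\<close> is constant in the inner expectation.\<close>
    have "Pi_pmf A d p = bind_pmf (Pi_pmf B d p) (\<lambda>js. map_pmf (\<lambda>a. js(t := a)) (p t))"
      unfolding A(1) Pi_pmf_insert[OF A(3,2)] pair_pmf_def map_bind_pmf
      by (subst bind_commute_pmf) (simp add: map_pmf_def bind_return_pmf bind_assoc_pmf)
    then have "measure_pmf.expectation (Pi_pmf A d p) (\<lambda>js. F js * H (js t)) =
        measure_pmf.expectation (Pi_pmf B d p) (\<lambda>js. measure_pmf.expectation (p t) (\<lambda>a. F js * H a))"
      using \<open>finite (set_pmf (Pi_pmf B d p))\<close> fin[OF \<open>t \<in> A\<close>]
      by (simp add: expectation_bind_pmf_finite F)
    then show ?thesis by simp
  qed
  show ?thesis
    using *[of G] *[of "\<lambda>_. 1"] by simp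
qed

section \<open>Rewards along histories and legal policies\<close>

text \<open>
  Both the profit and the used capacity of an agent are sums over accepted offers; \<open>reward\<close>
  lets one computation of the expectation serve both.
\<close>

definition reward :: "(('i, 'j) assignment \<Rightarrow> nat \<Rightarrow> real) \<Rightarrow> ('i, 'j) history \<Rightarrow> real" where
  "reward g h = (\<Sum>n<length h. case h ! n of Some (f, True) \<Rightarrow> g f (Suc n) | _ \<Rightarrow> 0)"

lemma reward_snoc:
  "reward g (h @ [e]) = reward g h + (case e of Some (f, True) \<Rightarrow> g f (Suc (length h)) | _ \<Rightarrow> 0)"
  by (simp add: reward_def nth_append cong: sum.cong_simp)

lemma total_profit_eq_reward: "total_profit M = reward (profit M)"
  by (simp add: fun_eq_iff total_profit_def reward_def)

lemma used_snoc:
  "used (h @ [e]) i = used h i + (case e of Some (f, True) \<Rightarrow> of_bool (fst f = i) | _ \<Rightarrow> 0)"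
  by (auto simp: used_def split: option.splits bool.splits)

lemma used_eq_reward: "real (used h i) = reward (\<lambda>f t. of_bool (fst f = i)) h"
proof (induction h rule: rev_induct)
  case Nil
  show ?case by (simp add: used_def reward_def)
next
  case (snoc e h)
  then show ?case
    by (auto simp: used_snoc reward_snoc split: option.splits bool.splits)
qed

text \<open>
  Weaker than \<^const>\<open>clairvoyant_policy\<close> in that only arrival sequences of positive probability
  are constrained; the sampling distribution is under control only for those.
\<close>

definition legal_policy :: "('i, 'j) mp_khd \<Rightarrow> ('i, 'j) policy \<Rightarrow> bool" where
  "legal_policy M \<pi> \<longleftrightarrow>
     (\<forall>js\<in>set_pmf (arrivals M). \<forall>h. length h < horizon M \<longrightarrow>
        set_pmf (\<pi> js h) \<subseteq>
          insert None (Some ` {f \<in> assignments_online M (js (Suc (length h))). available M h (fst f)}))"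

lemma clairvoyant_imp_legal: "clairvoyant_policy M \<pi> \<Longrightarrow> legal_policy M \<pi>"
  by (auto simp: clairvoyant_policy_def legal_policy_def)

text \<open>The index \<open>n\<close> counts completed rounds, so the selection takes place in round \<open>Suc n\<close>.\<close>

definition select_prob :: "('i, 'j) mp_khd \<Rightarrow> ('i, 'j) policy \<Rightarrow> nat \<Rightarrow> ('i, 'j) assignment \<Rightarrow> real" where
  "select_prob M \<pi> n f =
     measure_pmf.expectation (arrivals M) (\<lambda>js.
       measure_pmf.expectation (run M \<pi> js n) (\<lambda>h. pmf (\<pi> js h) (Some f)))"

lemma length_run: "h \<in> set_pmf (run M \<pi> js n) \<Longrightarrow> length h = n"
  by (induction n arbitrary: h) auto

lemma finite_set_offer: "finite (set_pmf (offer M t c))"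
  by (cases c) (auto intro: finite_subset[OF subset_UNIV])

lemma finite_assignments_online: "valid_mp_khd M \<Longrightarrow> finite (assignments_online M j)"
  by (simp add: assignments_online_def finite_assignments)

lemma arrivals_component_in_set:
  assumes "valid_mp_khd M" "js \<in> set_pmf (arrivals M)" "t \<in> rounds M"
  shows "js t \<in> set_pmf (arrival M t)"
proof -
  have "js \<in> PiE_dflt (rounds M) undefined (\<lambda>x. set_pmf (arrival M x))"
    using assms(2) unfolding arrivals_def by (subst (asm) set_Pi_pmf) (auto simp: rounds_def o_def)
  then show ?thesis
    using assms(3) by (auto simp: PiE_dflt_def)
qed

lemma finite_set_arrival:
  assumes "valid_mp_khd M" "t \<in> rounds M"
  shows "finite (set_pmf (arrival M t))"
  using assms unfolding valid_mp_khd_def by (meson finite_subset)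

lemma finite_set_arrivals:
  assumes "valid_mp_khd M"
  shows "finite (set_pmf (arrivals M))"
  using finite_set_arrival[OF assms] by (auto simp: arrivals_def set_Pi_pmf rounds_def)

section \<open>Runs of a legal policy: expected rewards and the two families of LP
  constraints\<close>

context
  fixes M :: "('i, 'j) mp_khd" and \<pi> :: "('i, 'j) policy"
  assumes M: "valid_mp_khd M" and \<pi>: "legal_policy M \<pi>"
begin

lemma set_legal_policy:
  assumes "js \<in> set_pmf (arrivals M)" "length h < horizon M"
  shows "set_pmf (\<pi> js h) \<subseteq>
    insert None (Some ` {f \<in> assignments_online M (js (Suc (length h))). available M h (fst f)})"
  using \<pi> assms by (auto simp: legal_policy_def)

lemma finite_set_legal_policy:
  assumes "js \<in> set_pmf (arrivals M)" "length h < horizon M"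
  shows "finite (set_pmf (\<pi> js h))"
  by (rule finite_subset[OF set_legal_policy[OF assms]]) (use finite_assignments_online[OF M] in auto)

lemma finite_set_run:
  assumes "js \<in> set_pmf (arrivals M)" "n \<le> horizon M"
  shows "finite (set_pmf (run M \<pi> js n))"
  using assms(2)
proof (induction n)
  case (Suc n)
  then show ?case
    using assms(1) by (auto simp: finite_set_offer length_run intro!: finite_set_legal_policy)
qed auto

text \<open>Only an accepted offer raises \<open>used\<close>, by one, and a legal policy makes an
  offer only while \<open>used\<close> is strictly below the capacity.\<close>

lemma used_run_le_capacity:
  assumes "js \<in> set_pmf (arrivals M)" "n \<le> horizon M" "h \<in> set_pmf (run M \<pi> js n)"
  shows "used h i \<le> capacity M i"
  using assms(2,3)
proof (induction n arbitrary: h)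
  case 0
  then show ?case by (simp add: used_def)
next
  case (Suc n)
  then obtain h' c e where h': "h' \<in> set_pmf (run M \<pi> js n)" and c: "c \<in> set_pmf (\<pi> js h')"
    and e: "e \<in> set_pmf (offer M (Suc n) c)" and h: "h = h' @ [e]"
    by auto
  have "used h' i \<le> capacity M i"
    using Suc h' by auto
  moreover have "used h' i < capacity M i" if "c = Some f" "fst f = i" for f
  proof -
    have "available M h' (fst f)"
      using set_legal_policy[OF assms(1), of h'] c that(1) Suc.prems(1) length_run[OF h'] by auto
    then show ?thesis using that by (simp add: available_def)
  qed
  ultimately show ?case
    using e by (cases c) (auto simp: h used_snoc split: bool.splits)
qed

text \<open>The condition on \<open>G None\<close> removes the rejection term. Summing over all
  assignments, not just those of the arriving type, keeps the index set independent of
  \<open>js\<close> and \<open>h\<close>, so that sums can later be exchanged with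
  expectations.\<close>

lemma expectation_policy:
  assumes "js \<in> set_pmf (arrivals M)" "length h < horizon M" and "G None = 0"
  shows "measure_pmf.expectation (\<pi> js h) G =
    (\<Sum>f\<in>assignments M. pmf (\<pi> js h) (Some f) * G (Some f))"
proof -
  have "measure_pmf.expectation (\<pi> js h) G =
      (\<Sum>c\<in>insert None (Some ` assignments M). pmf (\<pi> js h) c *\<^sub>R G c)"
    by (rule integral_measure_pmf)
      (use finite_assignments[OF M] set_legal_policy[OF assms(1,2)] in \<open>auto simp: assignments_online_def\<close>)
  then show ?thesis
    using assms finite_assignments[OF M] by (simp add: sum.reindex)
qed

lemma expectation_offer:
  fixes G :: "('i, 'j) assignment \<Rightarrow> real"
  assumes "c \<in> insert None (Some ` assignments M)" "t \<in> rounds M"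
  shows "measure_pmf.expectation (offer M t c) (\<lambda>e. case e of Some (f, True) \<Rightarrow> G f | _ \<Rightarrow> 0) =
    (case c of Some f \<Rightarrow> accept_prob M f t * G f | None \<Rightarrow> 0)"
proof (cases c)
  case (Some f)
  then have "0 \<le> accept_prob M f t" "accept_prob M f t \<le> 1"
    using assms M by (auto simp: valid_mp_khd_def less_imp_le)
  then show ?thesis
    using Some by simp
qed auto

text \<open>Linearity over rounds: given the history, acceptance is independent of which assignment
  is selected, so each round contributes selection probability times acceptance probability times
  reward.\<close>

lemma expectation_reward_run:
  assumes "js \<in> set_pmf (arrivals M)" "n \<le> horizon M"
  shows "measure_pmf.expectation (run M \<pi> js n) (reward g) =
    (\<Sum>m<n. \<Sum>f\<in>assignments M.
       measure_pmf.expectation (run M \<pi> js m) (\<lambda>h. pmf (\<pi> js h) (Some f)) *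
       accept_prob M f (Suc m) * g f (Suc m))"
  using assms(2)
proof (induction n)
  case 0
  then show ?case by (simp add: reward_def)
next
  case (Suc n)
  let ?R = "run M \<pi> js n"
  let ?G = "\<lambda>f. accept_prob M f (Suc n) * g f (Suc n)"
  have n: "n < horizon M" "Suc n \<in> rounds M"
    using Suc.prems by (auto simp: rounds_def)
  have finR: "finite (set_pmf ?R)"
    using finite_set_run[OF assms(1)] n by simp
  have fin\<pi>: "finite (set_pmf (\<pi> js h))" if "h \<in> set_pmf ?R" for h
    using finite_set_legal_policy[OF assms(1)] n length_run[OF that] by simp
  have fino: "integrable (offer M (Suc n) c) G" for c and G :: "_ \<Rightarrow> real"
    by (rule integrable_measure_pmf_finite) (rule finite_set_offer)
  \<comment> \<open>Conditionally on \<open>h\<close> the past reward is a constant; only the new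
    entry is averaged.\<close>
  have step: "measure_pmf.expectation (bind_pmf (\<pi> js h) (\<lambda>c. map_pmf (\<lambda>e. h @ [e]) (offer M (Suc n) c))) (reward g)
      = reward g h + (\<Sum>f\<in>assignments M. pmf (\<pi> js h) (Some f) * ?G f)"
    if h: "h \<in> set_pmf ?R" for h
  proof -
    have len: "length h = n" using length_run[OF h] .
    have sub: "set_pmf (\<pi> js h) \<subseteq> insert None (Some ` assignments M)"
      using set_legal_policy[OF assms(1), of h] n len by (auto simp: assignments_online_def)
    have "measure_pmf.expectation (bind_pmf (\<pi> js h) (\<lambda>c. map_pmf (\<lambda>e. h @ [e]) (offer M (Suc n) c))) (reward g)
        = measure_pmf.expectation (\<pi> js h) (\<lambda>c. measure_pmf.expectation (offer M (Suc n) c)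
            (\<lambda>e. reward g h + (case e of Some (f, True) \<Rightarrow> g f (Suc n) | _ \<Rightarrow> 0)))"
      by (subst expectation_bind_pmf_finite) (simp_all add: fin\<pi>[OF h] finite_set_offer reward_snoc[of g h, unfolded len])
    also have "\<dots> = measure_pmf.expectation (\<pi> js h)
        (\<lambda>c. reward g h + (case c of Some f \<Rightarrow> ?G f | None \<Rightarrow> 0))"
    proof (rule expectation_cong_pmf)
      fix c assume "c \<in> set_pmf (\<pi> js h)"
      then have "c \<in> insert None (Some ` assignments M)" using sub by blast
      from expectation_offer[OF this n(2), of "\<lambda>f. g f (Suc n)"]
      show "measure_pmf.expectation (offer M (Suc n) c)
            (\<lambda>e. reward g h + (case e of Some (f, True) \<Rightarrow> g f (Suc n) | _ \<Rightarrow> 0)) =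
          reward g h + (case c of Some f \<Rightarrow> ?G f | None \<Rightarrow> 0)"
        by (subst Bochner_Integration.integral_add) (simp_all add: fino)
    qed
    also have "\<dots> = reward g h + measure_pmf.expectation (\<pi> js h) (\<lambda>c. case c of Some f \<Rightarrow> ?G f | None \<Rightarrow> 0)"
      by (subst Bochner_Integration.integral_add)
        (auto intro: integrable_measure_pmf_finite[OF fin\<pi>[OF h]])
    finally show ?thesis
      by (subst (asm) expectation_policy) (use assms(1) n len in simp_all)
  qed
  have "measure_pmf.expectation (run M \<pi> js (Suc n)) (reward g) =
      measure_pmf.expectation ?R (\<lambda>h. reward g h + (\<Sum>f\<in>assignments M. pmf (\<pi> js h) (Some f) * ?G f))"
    unfolding run.simps
    by (subst expectation_bind_pmf_finite)
      (auto simp: finR fin\<pi> finite_set_offer step intro!: expectation_cong_pmf)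
  also have "\<dots> = measure_pmf.expectation ?R (reward g) +
      (\<Sum>f\<in>assignments M. measure_pmf.expectation ?R (\<lambda>h. pmf (\<pi> js h) (Some f)) * ?G f)"
    by (simp add: Bochner_Integration.integral_sum integrable_measure_pmf_finite[OF finR])
  finally show ?case
    using Suc by (simp add: mult.assoc)
qed

lemma expectation_reward:
  assumes "n \<le> horizon M"
  shows "measure_pmf.expectation (arrivals M) (\<lambda>js. measure_pmf.expectation (run M \<pi> js n) (reward g)) =
    (\<Sum>m<n. \<Sum>f\<in>assignments M. select_prob M \<pi> m f * accept_prob M f (Suc m) * g f (Suc m))"
proof -
  note int = integrable_measure_pmf_finite[OF finite_set_arrivals[OF M]]
  have "measure_pmf.expectation (arrivals M) (\<lambda>js. measure_pmf.expectation (run M \<pi> js n) (reward g)) =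
    measure_pmf.expectation (arrivals M) (\<lambda>js. \<Sum>m<n. \<Sum>f\<in>assignments M.
       measure_pmf.expectation (run M \<pi> js m) (\<lambda>h. pmf (\<pi> js h) (Some f)) *
       accept_prob M f (Suc m) * g f (Suc m))"
    by (rule expectation_cong_pmf) (rule expectation_reward_run[OF _ assms])
  then show ?thesis
    by (simp add: Bochner_Integration.integral_sum int select_prob_def)
qed

lemma expected_profit_eq:
  "expected_profit M \<pi> =
    (\<Sum>m<horizon M. \<Sum>f\<in>assignments M. select_prob M \<pi> m f * accept_prob M f (Suc m) * profit M f (Suc m))"
  unfolding expected_profit_def total_profit_eq_reward
  by (subst expectation_bind_pmf_finite)
    (auto simp: finite_set_arrivals[OF M] finite_set_run expectation_reward)

lemma expectation_used:
  assumes "n \<le> horizon M"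
  shows "measure_pmf.expectation (arrivals M)
      (\<lambda>js. measure_pmf.expectation (run M \<pi> js n) (\<lambda>h. real (used h i))) =
    (\<Sum>m<n. \<Sum>f\<in>assignments_offline M i. select_prob M \<pi> m f * accept_prob M f (Suc m))"
  unfolding used_eq_reward expectation_reward[OF assms] assignments_offline_def
  by (simp add: finite_assignments[OF M] sum.inter_filter of_bool_def if_distrib cong: if_cong)

lemma select_prob_nonneg: "select_prob M \<pi> m f \<ge> 0"
  unfolding select_prob_def by (intro integral_nonneg_AE AE_I2) simp

text \<open>The left-hand side is the expected used capacity after the last round, and the capacity
  bound holds in every possible run.\<close>

lemma sum_select_prob_offline_le:
  "(\<Sum>m<horizon M. \<Sum>f\<in>assignments_offline M i. select_prob M \<pi> m f * accept_prob M f (Suc m)) \<le> capacity M i"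
proof -
  have "measure_pmf.expectation (arrivals M)
      (\<lambda>js. measure_pmf.expectation (run M \<pi> js (horizon M)) (\<lambda>h. real (used h i)))
    \<le> measure_pmf.expectation (arrivals M)
      (\<lambda>js. measure_pmf.expectation (run M \<pi> js (horizon M)) (\<lambda>h. real (capacity M i)))"
    by (intro expectation_mono_finite finite_set_arrivals M finite_set_run)
      (auto intro: used_run_le_capacity)
  then show ?thesis
    by (simp add: expectation_used)
qed

text \<open>A round selects at most one assignment, and only one of the arriving type. The bound by
  the indicator of that arrival holds for each fixed \<open>js\<close>, so it is valid even if the
  policy knows all of \<open>js\<close>.\<close>

lemma sum_select_prob_online_le:
  assumes "m < horizon M"
  shows "(\<Sum>f\<in>assignments_online M j. select_prob M \<pi> m f) \<le> pmf (arrival M (Suc m)) j"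
proof -
  note intA = integrable_measure_pmf_finite[OF finite_set_arrivals[OF M]]
  have le: "(\<Sum>f\<in>assignments_online M j. pmf (\<pi> js h) (Some f)) \<le> indicator {j} (js (Suc m))"
    if js: "js \<in> set_pmf (arrivals M)" and h: "h \<in> set_pmf (run M \<pi> js m)" for js h
  proof (cases "js (Suc m) = j")
    case True
    \<comment> \<open>The sum is the probability of a single event, hence at most 1.\<close>
    have "(\<Sum>f\<in>assignments_online M j. pmf (\<pi> js h) (Some f)) =
        measure_pmf.prob (\<pi> js h) (Some ` assignments_online M j)"
      by (simp add: measure_measure_pmf_finite finite_assignments_online[OF M] sum.reindex)
    then show ?thesis using True by simp
  next
    case False
    have "pmf (\<pi> js h) (Some f) = 0" if "f \<in> assignments_online M j" for f
      using set_legal_policy[OF js, of h] length_run[OF h] assms False that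
      by (auto simp: set_pmf_iff assignments_online_def)
    then show ?thesis using False by simp
  qed
  have "(\<Sum>f\<in>assignments_online M j. select_prob M \<pi> m f) =
      measure_pmf.expectation (arrivals M) (\<lambda>js. \<Sum>f\<in>assignments_online M j.
        measure_pmf.expectation (run M \<pi> js m) (\<lambda>h. pmf (\<pi> js h) (Some f)))"
    unfolding select_prob_def by (simp add: Bochner_Integration.integral_sum intA)
  also have "\<dots> \<le> measure_pmf.expectation (arrivals M) (\<lambda>js. indicator {j} (js (Suc m)))"
  proof (rule expectation_mono_finite[OF finite_set_arrivals[OF M]])
    fix js assume js: "js \<in> set_pmf (arrivals M)"
    note finR = finite_set_run[OF js less_imp_le[OF assms]]
    have "(\<Sum>f\<in>assignments_online M j. measure_pmf.expectation (run M \<pi> js m) (\<lambda>h. pmf (\<pi> js h) (Some f)))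
       = measure_pmf.expectation (run M \<pi> js m) (\<lambda>h. \<Sum>f\<in>assignments_online M j. pmf (\<pi> js h) (Some f))"
      by (rule Bochner_Integration.integral_sum[symmetric]) (rule integrable_measure_pmf_finite[OF finR])
    also have "\<dots> \<le> measure_pmf.expectation (run M \<pi> js m) (\<lambda>h. indicator {j} (js (Suc m)))"
      by (rule expectation_mono_finite[OF finR]) (rule le[OF js])
    finally show "(\<Sum>f\<in>assignments_online M j. measure_pmf.expectation (run M \<pi> js m) (\<lambda>h. pmf (\<pi> js h) (Some f)))
       \<le> indicator {j} (js (Suc m))" by simp
  qed
  also have "\<dots> = measure_pmf.expectation (map_pmf (\<lambda>js. js (Suc m)) (arrivals M)) (indicator {j})"
    by (rule integral_map_pmf[symmetric])
  also have "map_pmf (\<lambda>js. js (Suc m)) (arrivals M) = arrival M (Suc m)"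
    unfolding arrivals_def by (subst Pi_pmf_component) (use assms in \<open>auto simp: rounds_def\<close>)
  finally show ?thesis
    by (simp add: measure_pmf_single)
qed

end


section \<open>Unit copies and the LP bound on the clairvoyant optimum\<close>

lemma sum_rounds: "sum g (rounds M) = (\<Sum>m<horizon M. g (Suc m))"
  unfolding rounds_def One_nat_def by (rule sum.atLeast1_atMost_eq)

definition original :: "('i \<times> nat, 'j) assignment \<Rightarrow> ('i, 'j) assignment" where
  "original = (\<lambda>((i, c), j, k). (i, j, k))"

lemma horizon_unit_copies [simp]: "horizon (unit_copies M) = horizon M"
  and rounds_unit_copies [simp]: "rounds (unit_copies M) = rounds M"
  and arrival_unit_copies [simp]: "arrival (unit_copies M) = arrival M"
  and capacity_unit_copies [simp]: "capacity (unit_copies M) i = 1"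
  by (simp_all add: unit_copies_def rounds_def)

lemma accept_prob_unit_copies [simp]: "accept_prob (unit_copies M) f = accept_prob M (original f)"
  and profit_unit_copies [simp]: "profit (unit_copies M) f = profit M (original f)"
  by (auto simp: unit_copies_def original_def split: prod.splits)

lemma assignments_unit_copies:
  "assignments (unit_copies M) =
    {f. original f \<in> assignments M \<and> snd (fst f) \<in> {1..capacity M (fst (fst f))}}"
  by (auto simp: unit_copies_def original_def assignments_def)

lemma assignments_online_unit_copies:
  "assignments_online (unit_copies M) j =
    {f. original f \<in> assignments_online M j \<and> snd (fst f) \<in> {1..capacity M (fst (fst f))}}"
  by (auto simp: assignments_online_def assignments_unit_copies original_def)

text \<open>Each assignment has as many copies as its offline agent has capacity, and each copy
  carries an equal share. The preimage form of the index set matches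
  \<open>assignments_unit_copies\<close> and \<open>assignments_online_unit_copies\<close>.\<close>

lemma sum_unit_copies:
  fixes g :: "('i, 'j) assignment \<Rightarrow> real"
  assumes M: "valid_mp_khd M" and B: "B \<subseteq> assignments M"
  shows "(\<Sum>f | original f \<in> B \<and> snd (fst f) \<in> {1..capacity M (fst (fst f))}.
      g (original f) / capacity M (fst (fst f))) = sum g B"
proof -
  let ?copy = "\<lambda>((i, j, k), c). ((i, c), j, k)"
  have fin: "finite B"
    using finite_assignments[OF M] B by (rule finite_subset[rotated])
  have set: "{f. original f \<in> B \<and> snd (fst f) \<in> {1..capacity M (fst (fst f))}} =
      ?copy ` (SIGMA f:B. {1..capacity M (fst f)})"
    by (force simp: original_def image_iff)
  have inj: "inj_on ?copy (SIGMA f:B. {1..capacity M (fst f)})"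
    by (auto simp: inj_on_def)
  have "(\<Sum>f | original f \<in> B \<and> snd (fst f) \<in> {1..capacity M (fst (fst f))}.
      g (original f) / capacity M (fst (fst f))) =
      (\<Sum>(f, c)\<in>(SIGMA f:B. {1..capacity M (fst f)}). g f / capacity M (fst f))"
    unfolding set by (subst sum.reindex[OF inj]) (auto intro!: sum.cong simp: original_def)
  also have "\<dots> = (\<Sum>f\<in>B. \<Sum>c\<in>{1..capacity M (fst f)}. g f / capacity M (fst f))"
    using fin by (subst sum.Sigma) auto
  also have "\<dots> = sum g B"
  proof (rule sum.cong)
    fix f assume "f \<in> B"
    then have "fst f \<in> offline M"
      using B M by (force simp: valid_mp_khd_def assignments_def)
    \<comment> \<open>The shares add up because capacities of offline agents are positive.\<close>
    then show "(\<Sum>c\<in>{1..capacity M (fst f)}. g f / capacity M (fst f)) = g f"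
      using M by (simp add: valid_mp_khd_def)
  qed simp
  finally show ?thesis .
qed

text \<open>With the copy \<open>c\<close> fixed, every assignment of \<open>i\<close> occurs
  exactly once, so sums here are reindexed along a bijection and not collected over all
  copies.\<close>

lemma assignments_offline_unit_copies:
  assumes "c \<in> {1..capacity M i}"
  shows "assignments_offline (unit_copies M) (i, c) =
    (\<lambda>(i', j, k). ((i', c), j, k)) ` assignments_offline M i"
  using assms by (force simp: assignments_offline_def assignments_unit_copies original_def image_iff)

lemma expected_profit_le_lp_value:
  assumes M: "valid_mp_khd M" and \<pi>: "legal_policy M \<pi>" and x: "lp_optimal (unit_copies M) x"
  shows "expected_profit M \<pi> \<le> lp_value (unit_copies M) x"
proof -
  \<comment> \<open>The shift \<open>t - 1\<close> turns a round into the number of completed rounds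
    counted by \<open>select_prob\<close>.\<close>
  define y where "y f t = select_prob M \<pi> (t - 1) (original f) / capacity M (fst (fst f))"
    for f :: "('a \<times> nat, 'b) assignment" and t
  have "lp_feasible (unit_copies M) y"
    unfolding lp_feasible_def
  proof (intro conjI ballI)
    fix j t assume t: "t \<in> rounds (unit_copies M)"
    have "(\<Sum>f\<in>assignments_online (unit_copies M) j. y f t) =
        (\<Sum>f\<in>assignments_online M j. select_prob M \<pi> (t - 1) f)"
      unfolding assignments_online_unit_copies y_def
      by (rule sum_unit_copies[OF M]) (auto simp: assignments_online_def)
    also have "\<dots> \<le> pmf (arrival M t) j"
      using sum_select_prob_online_le[OF M \<pi>, of "t - 1" j] t by (auto simp: rounds_def)
    finally show "(\<Sum>f\<in>assignments_online (unit_copies M) j. y f t) \<le> pmf (arrival (unit_copies M) t) j"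
      by simp
  next
    fix a assume "a \<in> offline (unit_copies M)"
    then obtain i c where a: "a = (i, c)" and i: "i \<in> offline M" and c: "c \<in> {1..capacity M i}"
      by (auto simp: unit_copies_def)
    \<comment> \<open>One copy carries the fraction \<open>1 / capacity M i\<close> of the load of
      \<open>i\<close>, so the load bound \<open>capacity M i\<close> becomes 1.\<close>
    have "(\<Sum>f\<in>assignments_offline (unit_copies M) a. y f t * accept_prob (unit_copies M) f t) =
        (\<Sum>f\<in>assignments_offline M i. select_prob M \<pi> (t - 1) f * accept_prob M f t) / capacity M i" for t
      unfolding a assignments_offline_unit_copies[OF c] sum_divide_distrib
      by (subst sum.reindex)
        (auto intro!: sum.cong simp: inj_on_def y_def original_def assignments_offline_def)
    then have "(\<Sum>t\<in>rounds M. \<Sum>f\<in>assignments_offline (unit_copies M) a.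
          y f t * accept_prob (unit_copies M) f t) =
        (\<Sum>m<horizon M. \<Sum>f\<in>assignments_offline M i. select_prob M \<pi> m f * accept_prob M f (Suc m)) / capacity M i"
      by (simp add: sum_rounds sum_divide_distrib)
    also have "\<dots> \<le> 1"
      using sum_select_prob_offline_le[OF M \<pi>, of i] by (simp add: divide_le_eq)
    finally show "(\<Sum>t\<in>rounds (unit_copies M). \<Sum>f\<in>assignments_offline (unit_copies M) a.
        y f t * accept_prob (unit_copies M) f t) \<le> 1" by simp
  next
    fix f t
    show "0 \<le> y f t"
      by (simp add: y_def select_prob_nonneg[OF M \<pi>])
  qed
  then have "lp_value (unit_copies M) y \<le> lp_value (unit_copies M) x"
    using x by (simp add: lp_optimal_def)
  moreover have "(\<Sum>f\<in>assignments (unit_copies M). y f t * accept_prob (unit_copies M) f t * profit (unit_copies M) f t)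
      = (\<Sum>f\<in>assignments M. select_prob M \<pi> (t - 1) f * accept_prob M f t * profit M f t)" for t
    using sum_unit_copies[OF M subset_refl, of "\<lambda>f. select_prob M \<pi> (t - 1) f * accept_prob M f t * profit M f t"]
    by (simp add: assignments_unit_copies y_def)
  then have "lp_value (unit_copies M) y = expected_profit M \<pi>"
    by (simp add: lp_value_def sum_rounds expected_profit_eq[OF M \<pi>])
  ultimately show ?thesis by simp
qed

lemma opt_off_le_lp_value:
  assumes "valid_mp_khd M" and "lp_optimal (unit_copies M) x"
  shows "opt_off M \<le> lp_value (unit_copies M) x"
  unfolding opt_off_def
proof (rule cSUP_least)
  \<comment> \<open>Rejecting everyone shows that the supremum is over a nonempty set, as
    \<open>cSUP_least\<close> requires.\<close>
  have "clairvoyant_policy M (\<lambda>js h. return_pmf None)"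
    by (simp add: clairvoyant_policy_def)
  then show "{\<pi>. clairvoyant_policy M \<pi>} \<noteq> {}" by blast
qed (use assms in \<open>auto intro: expected_profit_le_lp_value clairvoyant_imp_legal\<close>)

section \<open>Lower bound on the profit of the sampling policy\<close>

text \<open>An online policy reads only arrivals up to the current round. This makes the history
  before a round independent of the arrival in that round.\<close>

lemma run_online_policy_cong:
  assumes "\<And>t. t \<in> {1..n} \<Longrightarrow> js t = js' t"
  shows "run M (online_policy \<sigma>) js n = run M (online_policy \<sigma>) js' n"
  using assms
proof (induction n)
  case (Suc n)
  have "run M (online_policy \<sigma>) js n = run M (online_policy \<sigma>) js' n"
    using Suc by simp
  then show ?case
    using Suc.prems by (auto simp: online_policy_def length_run intro!: bind_pmf_cong)
qed simp

context
  fixes M :: "('i, 'j) mp_khd" and \<gamma> :: real and x :: "('i, 'j) assignment \<Rightarrow> nat \<Rightarrow> real"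
  assumes M: "valid_mp_khd M" and x: "lp_feasible M x" and \<gamma>: "0 \<le> \<gamma>" "\<gamma> \<le> 1"
begin

text \<open>The filter never turns one assignment into another: \<open>Some f\<close> results only
  from sampling \<open>f\<close> while its agent is available. Positive probability of
  \<open>js\<close> ensures that the arriving type is online, as \<open>pmf_sample\<close>
  requires.\<close>

lemma pmf_samp:
  assumes "js \<in> set_pmf (arrivals M)" "length h < horizon M"
  shows "pmf (samp M \<gamma> x js h) (Some f) =
    of_bool (available M h (fst f)) * sample_weight M \<gamma> x (Suc (length h)) (js (Suc (length h))) (Some f)"
proof -
  have t: "Suc (length h) \<in> rounds M"
    using assms(2) by (simp add: rounds_def)
  have j: "js (Suc (length h)) \<in> online M"
    using arrivals_component_in_set[OF M assms(1) t] M t by (auto simp: valid_mp_khd_def)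
  have "(\<lambda>c. case c of Some f \<Rightarrow> if available M h (fst f) then Some f else None | None \<Rightarrow> None) -` {Some f} =
      (if available M h (fst f) then {Some f} else {})"
    by (auto split: option.splits if_splits)
  then show ?thesis
    by (simp add: samp_def online_policy_def pmf_map measure_pmf_single pmf_sample[OF M x \<gamma> j t])
qed

lemma legal_samp: "legal_policy M (samp M \<gamma> x)"
  unfolding legal_policy_def
proof (intro ballI allI impI subsetI)
  fix js h c
  assume h: "js \<in> set_pmf (arrivals M)" "length h < horizon M" and c: "c \<in> set_pmf (samp M \<gamma> x js h)"
  show "c \<in> insert None (Some ` {f \<in> assignments_online M (js (Suc (length h))). available M h (fst f)})"
    using pmf_samp[OF h] c by (cases c) (auto simp: set_pmf_iff sample_weight_def split: if_splits)
qed

lemma lp_solution_nonneg: "f \<in> assignments M \<Longrightarrow> t \<in> rounds M \<Longrightarrow> 0 \<le> x f t"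
  using x by (simp add: lp_feasible_def)

text \<open>Forces \<open>x f t\<close> to vanish when the type of \<open>f\<close> has arrival
  probability 0, which makes the division by that probability harmless.\<close>

lemma lp_solution_le_arrival:
  assumes "f \<in> assignments M" "t \<in> rounds M"
  shows "x f t \<le> pmf (arrival M t) (fst (snd f))"
proof -
  have "fst (snd f) \<in> online M"
    using assms M by (auto simp: valid_mp_khd_def assignments_def)
  moreover have "x f t \<le> (\<Sum>f\<in>assignments_online M (fst (snd f)). x f t)"
    by (rule member_le_sum)
      (use assms in \<open>auto simp: assignments_online_def finite_assignments[OF M] lp_solution_nonneg\<close>)
  ultimately show ?thesis
    using x assms by (force simp: lp_feasible_def)
qed

text \<open>
  The history before round \<open>t\<close> is independent of the arrival in round \<open>t\<close>, so the sampling
  probability \<open>\<gamma> x / q\<close> and the arrival probability \<open>q\<close> multiply to \<open>\<gamma> x\<close>.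
\<close>

lemma select_prob_samp:
  assumes m: "m < horizon M" and f: "f \<in> assignments M"
  shows "select_prob M (samp M \<gamma> x) m f = \<gamma> * x f (Suc m) *
    measure_pmf.expectation (arrivals M) (\<lambda>js.
      measure_pmf.expectation (run M (samp M \<gamma> x) js m) (\<lambda>h. of_bool (available M h (fst f))))"
proof -
  define j where "j = fst (snd f)"
  define q where "q = pmf (arrival M (Suc m)) j"
  define F where "F js = measure_pmf.expectation (run M (samp M \<gamma> x) js m)
    (\<lambda>h. of_bool (available M h (fst f)) :: real)" for js
  have t: "Suc m \<in> rounds M"
    using m by (simp add: rounds_def)
  have "measure_pmf.expectation (run M (samp M \<gamma> x) js m) (\<lambda>h. pmf (samp M \<gamma> x js h) (Some f)) =
      F js * (indicator {j} (js (Suc m)) * (\<gamma> * x f (Suc m) / q))"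
    if js: "js \<in> set_pmf (arrivals M)" for js
  proof -
    have "measure_pmf.expectation (run M (samp M \<gamma> x) js m) (\<lambda>h. pmf (samp M \<gamma> x js h) (Some f)) =
        measure_pmf.expectation (run M (samp M \<gamma> x) js m) (\<lambda>h. of_bool (available M h (fst f)) *
          (indicator {j} (js (Suc m)) * (\<gamma> * x f (Suc m) / q)))"
    proof (rule expectation_cong_pmf)
      fix h assume "h \<in> set_pmf (run M (samp M \<gamma> x) js m)"
      then have len: "length h = m" by (rule length_run)
      show "pmf (samp M \<gamma> x js h) (Some f) =
          of_bool (available M h (fst f)) * (indicator {j} (js (Suc m)) * (\<gamma> * x f (Suc m) / q))"
        using pmf_samp[OF js, of h f] m f
        by (simp add: len sample_weight_def assignments_online_def j_def q_def indicator_def)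
    qed
    then show ?thesis by (simp add: F_def)
  qed
  then have "select_prob M (samp M \<gamma> x) m f =
      measure_pmf.expectation (arrivals M) (\<lambda>js. F js * (indicator {j} (js (Suc m)) * (\<gamma> * x f (Suc m) / q)))"
    unfolding select_prob_def by (rule expectation_cong_pmf)
  also have "\<dots> = measure_pmf.expectation (arrivals M) F *
      measure_pmf.expectation (arrival M (Suc m)) (\<lambda>j'. indicator {j} j' * (\<gamma> * x f (Suc m) / q))"
    unfolding arrivals_def
  proof (rule expectation_Pi_pmf_component_mult)
    \<comment> \<open>\<open>F\<close> involves only the first \<open>m\<close> rounds, and the
      changed arrival belongs to round \<open>Suc m\<close>.\<close>
    show "F (js(Suc m := a)) = F js" for js a
      unfolding F_def samp_def by (subst run_online_policy_cong[of m _ js]) auto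
  qed (use t finite_set_arrival[OF M] in \<open>auto simp: rounds_def\<close>)
  also have "measure_pmf.expectation (arrival M (Suc m)) (\<lambda>j'. indicator {j} j' * (\<gamma> * x f (Suc m) / q)) =
      q * (\<gamma> * x f (Suc m) / q)"
    by (simp add: q_def measure_pmf_single)
  \<comment> \<open>If \<open>q = 0\<close>, then \<open>x f (Suc m)\<close> lies between 0 and
    \<open>q\<close>, and both sides are 0.\<close>
  also have "\<dots> = \<gamma> * x f (Suc m)"
    using lp_solution_le_arrival[OF f t] lp_solution_nonneg[OF f t] by (cases "q = 0") (auto simp: q_def j_def)
  finally show ?thesis
    by (simp add: F_def[abs_def])
qed

lemma select_prob_samp_le:
  assumes m: "m < horizon M" and f: "f \<in> assignments M"
  shows "select_prob M (samp M \<gamma> x) m f \<le> \<gamma> * x f (Suc m)"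
proof -
  have "measure_pmf.expectation (arrivals M) (\<lambda>js.
      measure_pmf.expectation (run M (samp M \<gamma> x) js m) (\<lambda>h. of_bool (available M h (fst f)))) \<le>
    measure_pmf.expectation (arrivals M) (\<lambda>js. measure_pmf.expectation (run M (samp M \<gamma> x) js m) (\<lambda>h. 1 :: real))"
    using m by (intro expectation_mono_finite finite_set_arrivals M finite_set_run legal_samp) auto
  moreover have "0 \<le> \<gamma> * x f (Suc m)"
    using lp_solution_nonneg[OF f, of "Suc m"] m \<gamma> by (simp add: rounds_def)
  ultimately show ?thesis
    unfolding select_prob_samp[OF m f] by (intro mult_left_le) auto
qed

text \<open>Dropping the availability factor bounds each earlier selection probability by \<gamma>
  times the LP variable, so the expected use of the agent is at most \<gamma> times its LP load,
  which is at most 1.\<close>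

lemma availability_samp:
  assumes m: "m < horizon M" and f: "f \<in> assignments M" and cap: "capacity M (fst f) = 1"
  shows "1 - \<gamma> \<le> measure_pmf.expectation (arrivals M) (\<lambda>js.
    measure_pmf.expectation (run M (samp M \<gamma> x) js m) (\<lambda>h. of_bool (available M h (fst f))))"
proof -
  let ?R = "run M (samp M \<gamma> x)" and ?i = "fst f"
  note finR = finite_set_run[OF M legal_samp _ less_imp_le[OF m]]
  note intA = integrable_measure_pmf_finite[OF finite_set_arrivals[OF M]]
  have p: "0 \<le> accept_prob M f (Suc n)" if "n < horizon M" "f \<in> assignments_offline M ?i" for n f
    using M that by (auto simp: valid_mp_khd_def assignments_offline_def rounds_def less_imp_le)
  have x0: "0 \<le> x f (Suc n)" if "n < horizon M" "f \<in> assignments_offline M ?i" for n f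
    using that by (auto simp: assignments_offline_def rounds_def intro!: lp_solution_nonneg)
  have "measure_pmf.expectation (arrivals M) (\<lambda>js. measure_pmf.expectation (?R js m) (\<lambda>h. real (used h ?i))) =
      (\<Sum>n<m. \<Sum>f\<in>assignments_offline M ?i. select_prob M (samp M \<gamma> x) n f * accept_prob M f (Suc n))"
    by (rule expectation_used[OF M legal_samp less_imp_le[OF m]])
  also have "\<dots> \<le> (\<Sum>n<m. \<Sum>f\<in>assignments_offline M ?i. \<gamma> * x f (Suc n) * accept_prob M f (Suc n))"
    using m by (intro sum_mono mult_right_mono select_prob_samp_le p) (auto simp: assignments_offline_def)
  \<comment> \<open>Nonnegative terms for the remaining rounds are added to reach the full LP
    constraint.\<close>
  also have "\<dots> \<le> (\<Sum>n<horizon M. \<Sum>f\<in>assignments_offline M ?i. \<gamma> * x f (Suc n) * accept_prob M f (Suc n))"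
    using m \<gamma> by (intro sum_mono2) (auto intro!: sum_nonneg mult_nonneg_nonneg p x0)
  also have "\<dots> = \<gamma> * (\<Sum>t\<in>rounds M. \<Sum>f\<in>assignments_offline M ?i. x f t * accept_prob M f t)"
    by (simp add: sum_rounds sum_distrib_left mult.assoc)
  also have "\<dots> \<le> \<gamma>"
  proof -
    have "?i \<in> offline M"
      using f M by (auto simp: valid_mp_khd_def assignments_def)
    then show ?thesis
      using x \<gamma> by (intro mult_left_le) (auto simp: lp_feasible_def)
  qed
  finally have "1 - \<gamma> \<le> measure_pmf.expectation (arrivals M)
      (\<lambda>js. 1 - measure_pmf.expectation (?R js m) (\<lambda>h. real (used h ?i)))"
    by (simp add: intA)
  also have "\<dots> \<le> measure_pmf.expectation (arrivals M)
      (\<lambda>js. measure_pmf.expectation (?R js m) (\<lambda>h. of_bool (available M h ?i)))"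
  proof (rule expectation_mono_finite[OF finite_set_arrivals[OF M]])
    fix js assume js: "js \<in> set_pmf (arrivals M)"
    have "1 - measure_pmf.expectation (?R js m) (\<lambda>h. real (used h ?i)) =
        measure_pmf.expectation (?R js m) (\<lambda>h. 1 - real (used h ?i))"
      by (simp add: integrable_measure_pmf_finite[OF finR[OF js]])
    also have "\<dots> \<le> measure_pmf.expectation (?R js m) (\<lambda>h. of_bool (available M h ?i))"
      by (rule expectation_mono_finite[OF finR[OF js]]) (auto simp: available_def cap)
    finally show "1 - measure_pmf.expectation (?R js m) (\<lambda>h. real (used h ?i)) \<le>
        measure_pmf.expectation (?R js m) (\<lambda>h. of_bool (available M h ?i))" .
  qed
  finally show ?thesis .
qed

text \<open>The comparison is term by term: the sampling policy selects each assignment with at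
  least a fraction \<open>1 - \<gamma>\<close> of its sampling rate \<gamma> times \<open>x\<close>,
  and the weights are nonnegative.\<close>

lemma expected_profit_samp_ge:
  assumes cap: "\<And>i. i \<in> offline M \<Longrightarrow> capacity M i = 1"
  shows "\<gamma> * (1 - \<gamma>) * lp_value M x \<le> expected_profit M (samp M \<gamma> x)"
proof -
  have "\<gamma> * (1 - \<gamma>) * lp_value M x = (\<Sum>m<horizon M. \<Sum>f\<in>assignments M.
      \<gamma> * x f (Suc m) * (1 - \<gamma>) * accept_prob M f (Suc m) * profit M f (Suc m))"
    by (simp add: lp_value_def sum_rounds sum_distrib_left mult_ac)
  also have "\<dots> \<le> (\<Sum>m<horizon M. \<Sum>f\<in>assignments M.
      select_prob M (samp M \<gamma> x) m f * accept_prob M f (Suc m) * profit M f (Suc m))"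
  proof (intro sum_mono mult_right_mono)
    fix m f assume m: "m \<in> {..<horizon M}" and f: "f \<in> assignments M"
    then have t: "Suc m \<in> rounds M" by (simp add: rounds_def)
    then show "0 \<le> accept_prob M f (Suc m)" "0 \<le> profit M f (Suc m)"
      using M f by (auto simp: valid_mp_khd_def less_imp_le)
    have "fst f \<in> offline M"
      using f M by (auto simp: valid_mp_khd_def assignments_def)
    then show "\<gamma> * x f (Suc m) * (1 - \<gamma>) \<le> select_prob M (samp M \<gamma> x) m f"
      using m f lp_solution_nonneg[OF f t] \<gamma>
      by (subst select_prob_samp) (auto intro!: mult_left_mono availability_samp cap)
  qed
  finally show ?thesis
    by (simp add: expected_profit_eq[OF M legal_samp])
qed

end

theorem theorem3p1:
  fixes M :: "('i, 'j) mp_khd" and \<gamma> :: real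
    and x :: "('i \<times> nat, 'j) assignment \<Rightarrow> nat \<Rightarrow> real"
  assumes "valid_mp_khd M"
    and "0 \<le> \<gamma>" and "\<gamma> \<le> 1"
    and "lp_optimal (unit_copies M) x"
  shows "expected_profit (unit_copies M) (samp (unit_copies M) \<gamma> x) \<ge> \<gamma> * (1 - \<gamma>) * opt_off M"
proof -
  have "\<gamma> * (1 - \<gamma>) * opt_off M \<le> \<gamma> * (1 - \<gamma>) * lp_value (unit_copies M) x"
    using assms by (intro mult_left_mono opt_off_le_lp_value) auto
  also have "\<dots> \<le> expected_profit (unit_copies M) (samp (unit_copies M) \<gamma> x)"
    using assms by (intro expected_profit_samp_ge valid_unit_copies) (auto simp: lp_optimal_def)
  finally show ?thesis .
qed

end
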